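(* Let $n\ge 1$, $N\ge 1$, $\tau>0$, $\varepsilon>0$, and let $V_X\in C^2(\mathbb{R})$ be a real-valued function for each $X\in\mathbb{Z}^n$. Let $\psi:\mathbb{Z}^n\times\mathbb{Z}\to\mathbb{C}^N$ be a solution to the discrete nonlinear wave equation $$\frac{\psi_X^{T+1}-2\psi_X^T+\psi_X^{T-1}}{\tau^2}=\sum_{j=1}^n\frac{\psi_{X+e_j}^T-2\psi_X^T+\psi_{X-e_j}^T}{\varepsilon^2}-B_X(|\psi_X^{T+1}|^2,|\psi_X^{T-1}|^2)\,(\psi_X^{T+1}+\psi_X^{T-1}),\qquad (X,T)\in\mathbb{Z}^n\times\mathbb{Z},$$ such that $\psi^T\in l^2(\mathbb{Z}^n)$ for all $T\in\mathbb{Z}$. Then the discrete energy $$E^T=\sum_{X\in\mathbb{Z}^n}\Big[\Big(\frac{1}{\tau^2}-\frac{n}{\varepsilon^2}\Big)\frac{|\psi_X^{T+1}-\psi_X^T|^2}{2}+\sum_{j=1}^n\sum_{\pm}\frac{|\psi_X^{T+1}-\psi_{X\pm e_j}^T|^2}{4\varepsilon^2}+\frac{V_X(|\psi_X^{T+1}|^2)+V_X(|\psi_X^T|^2)}{2}\Big]\varepsilon^n$$ is conserved, that is, $E^T=E^{T-1}$ for all $T\in\mathbb{Z}$.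
   Context: $\psi_X^T$ denotes the value of $\psi$ at $(X,T)\in\mathbb{Z}^n\times\mathbb{Z}$, and $\psi^T$ the function $X\mapsto\psi_X^T$ on $\mathbb{Z}^n$. Here $e_1,\dots,e_n$ is the standard basis of $\mathbb{Z}^n$, $|\psi|^2=\bar\psi\cdot\psi$ for $\psi\in\mathbb{C}^N$, and $l^2(\mathbb{Z}^n)$ is the space of square-summable $\mathbb{C}^N$-valued functions on $\mathbb{Z}^n$. The functions $V_X$ are given by $V_X(\lambda)=v(\varepsilon X,\lambda)$, where $v\in C(\mathbb{R}^n\times\mathbb{R})$ is such that $v(x,\cdot)\in C^2(\mathbb{R})$ for each $x\in\mathbb{R}^n$. For $X\in\mathbb{Z}^n$ and $\lambda,\mu\in\mathbb{R}$, $$B_X(\lambda,\mu)=\frac{V_X(\lambda)-V_X(\mu)}{\lambda-\mu}\ \text{ if }\lambda\ne\mu,\qquad B_X(\lambda,\lambda)=\partial_\lambda V_X(\lambda).$$ *)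

theory Defs
  imports "HOL-Analysis.Analysis"
begin

text \<open>The dimensions n and N are the cardinalities of the index types: a lattice point is
  \<open>X :: int^'n\<close>, a field value lies in \<open>complex^'N\<close>, and \<open>e\<^sub>j\<close> is \<open>axis j 1\<close>.
  The value of the field at \<open>(X, T)\<close> is \<open>\<psi> X T\<close>.\<close>

lemma norm_sq_eq_cnj_dot:
  fixes z :: "complex^'N"
  shows "complex_of_real ((norm z)\<^sup>2) = (\<Sum>k\<in>UNIV. cnj (z $ k) * z $ k)"
  by (simp add: norm_vec_def L2_set_def sum_nonneg complex_norm_square mult.commute
      del: of_real_power)

definition C2 :: "(real \<Rightarrow> real) \<Rightarrow> bool" where
  "C2 f \<longleftrightarrow>
     (\<forall>x. f differentiable (at x)) \<and>
     (\<forall>x. deriv f differentiable (at x)) \<and>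
     continuous_on UNIV (deriv (deriv f))"

definition in_l2 :: "(int^'n \<Rightarrow> complex^'N) \<Rightarrow> bool" where
  "in_l2 f \<longleftrightarrow> (\<lambda>X. (norm (f X))\<^sup>2) summable_on UNIV"

definition diff_quot :: "(real \<Rightarrow> real) \<Rightarrow> real \<Rightarrow> real \<Rightarrow> real" where
  "diff_quot W a b = (if a \<noteq> b then (W a - W b) / (a - b) else deriv W a)"

definition discrete_wave_eq ::
  "real \<Rightarrow> real \<Rightarrow> (int^'n \<Rightarrow> real \<Rightarrow> real) \<Rightarrow> (int^'n \<Rightarrow> int \<Rightarrow> complex^'N) \<Rightarrow> bool" where
  "discrete_wave_eq \<tau> \<epsilon> V \<psi> \<longleftrightarrow>
     (\<forall>X T. (\<psi> X (T + 1) - 2 *\<^sub>R \<psi> X T + \<psi> X (T - 1)) /\<^sub>R \<tau>\<^sup>2 =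
        (\<Sum>j\<in>UNIV. (\<psi> (X + axis j 1) T - 2 *\<^sub>R \<psi> X T + \<psi> (X - axis j 1) T) /\<^sub>R \<epsilon>\<^sup>2)
        - diff_quot (V X) ((norm (\<psi> X (T + 1)))\<^sup>2) ((norm (\<psi> X (T - 1)))\<^sup>2)
            *\<^sub>R (\<psi> X (T + 1) + \<psi> X (T - 1)))"

definition energy_density ::
  "real \<Rightarrow> real \<Rightarrow> (int^'n \<Rightarrow> real \<Rightarrow> real) \<Rightarrow> (int^'n \<Rightarrow> int \<Rightarrow> complex^'N)
     \<Rightarrow> int \<Rightarrow> int^'n \<Rightarrow> real" where
  "energy_density \<tau> \<epsilon> V \<psi> T X =
     ((1 / \<tau>\<^sup>2 - real CARD('n) / \<epsilon>\<^sup>2) * ((norm (\<psi> X (T + 1) - \<psi> X T))\<^sup>2 / 2)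
      + (\<Sum>j\<in>UNIV. (norm (\<psi> X (T + 1) - \<psi> (X + axis j 1) T))\<^sup>2 / (4 * \<epsilon>\<^sup>2)
                  + (norm (\<psi> X (T + 1) - \<psi> (X - axis j 1) T))\<^sup>2 / (4 * \<epsilon>\<^sup>2))
      + (V X ((norm (\<psi> X (T + 1)))\<^sup>2) + V X ((norm (\<psi> X T))\<^sup>2)) / 2) * \<epsilon> ^ CARD('n)"

text \<open>No growth or sign condition on \<open>V\<close> forces this series to converge; \<open>infsum\<close> is 0 when it
  does not, so statements about \<open>discrete_energy\<close> should track summability of the density.\<close>

definition discrete_energy ::
  "real \<Rightarrow> real \<Rightarrow> (int^'n \<Rightarrow> real \<Rightarrow> real) \<Rightarrow> (int^'n \<Rightarrow> int \<Rightarrow> complex^'N)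
     \<Rightarrow> int \<Rightarrow> real" where
  "discrete_energy \<tau> \<epsilon> V \<psi> T = (\<Sum>\<^sub>\<infinity>X. energy_density \<tau> \<epsilon> V \<psi> T X)"

end

theory Submission
  imports Defs
begin

text \<open>Pairing the equation with \<open>\<psi>\<^sup>T\<^sup>+\<^sup>1 - \<psi>\<^sup>T\<^sup>-\<^sup>1\<close> turns the potential term into the increment of
  \<open>V\<close> along \<open>|\<psi>|\<^sup>2\<close>, so the densities at \<open>T\<close> and \<open>T - 1\<close> differ by a combination of terms
  \<open>h(X + a) - h(X)\<close> in which \<open>h\<close> is quadratic in \<open>\<psi>\<^sup>T\<close> and \<open>\<psi>\<^sup>T\<^sup>-\<^sup>1\<close>. Each such \<open>h\<close> is summable because
  the fields are in \<open>l\<^sup>2\<close>, so the difference sums to zero even when the density itself,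
  because of \<open>V\<close>, is not summable.\<close>

lemma has_sum_minus:
  fixes f g :: "'a \<Rightarrow> 'b::topological_ab_group_add"
  assumes "(f has_sum a) A" "(g has_sum b) A"
  shows "((\<lambda>x. f x - g x) has_sum a - b) A"
  using has_sum_add[OF assms(1), of "\<lambda>x. - g x" "- b"] assms(2) by (simp add: has_sum_uminus)

lemma has_sum_zero_sum:
  fixes f :: "'i \<Rightarrow> 'a \<Rightarrow> 'b::topological_comm_monoid_add"
  assumes "\<And>i. i \<in> I \<Longrightarrow> (f i has_sum 0) A"
  shows "((\<lambda>x. \<Sum>i\<in>I. f i x) has_sum 0) A"
  using assms
  by (induction I rule: infinite_finite_induct) (auto intro!: has_sum_add[where a = 0 and b = 0, simplified])

lemma has_sum_translate:
  fixes h :: "'a::ab_group_add \<Rightarrow> 'b::{comm_monoid_add,topological_space}"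
  assumes "(h has_sum s) UNIV"
  shows "((\<lambda>X. h (X + a)) has_sum s) UNIV"
proof -
  have "bij_betw (\<lambda>X. X + a) UNIV UNIV"
    by (rule bij_betw_byWitness[where f' = "\<lambda>X. X - a"]) auto
  from has_sum_reindex_bij_betw[OF this, of h s] show ?thesis
    using assms by simp
qed

text \<open>Translation permutes the whole group and unordered sums ignore the order, so a discrete
  divergence sums to zero without boundary terms.\<close>

lemma has_sum_translate_diff:
  fixes h :: "'a::ab_group_add \<Rightarrow> real"
  assumes "h summable_on UNIV"
  shows "((\<lambda>X. h (X + a) - h X) has_sum 0) UNIV"
proof -
  obtain s where s: "(h has_sum s) UNIV"
    using assms summable_on_def by blast
  show ?thesis
    using has_sum_minus[OF has_sum_translate[OF s] s] by simp
qed

lemma summable_on_inner: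
  fixes f g :: "'a \<Rightarrow> 'b::real_inner"
  assumes "(\<lambda>x. (norm (f x))\<^sup>2) summable_on A" "(\<lambda>x. (norm (g x))\<^sup>2) summable_on A"
  shows "(\<lambda>x. f x \<bullet> g x) summable_on A"
proof -
  have s: "(\<lambda>x. (norm (f x))\<^sup>2 + (norm (g x))\<^sup>2) summable_on A"
    by (rule summable_on_add[OF assms])
  have le: "\<bar>f x \<bullet> g x\<bar> \<le> (norm (f x))\<^sup>2 + (norm (g x))\<^sup>2" for x
  proof -
    have "\<bar>f x \<bullet> g x\<bar> \<le> norm (f x) * norm (g x)"
      by (rule Cauchy_Schwarz_ineq2)
    also have "\<dots> \<le> (norm (f x))\<^sup>2 + (norm (g x))\<^sup>2"
      using sum_squares_bound[of "norm (f x)" "norm (g x)"]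
        mult_nonneg_nonneg[OF norm_ge_zero norm_ge_zero, of "f x" "g x"] by linarith
    finally show ?thesis .
  qed
  have "(\<lambda>x. norm (f x \<bullet> g x)) summable_on A"
    by (rule summable_on_comparison_test[OF s]) (use le in auto)
  then show ?thesis
    by (rule abs_summable_summable)
qed

text \<open>Adding or subtracting the null difference shows that \<open>f\<close> and
  \<open>g\<close> have exactly the same sums; when there is none, both values of
  \<open>infsum\<close> are 0.\<close>

lemma summable_infsum_cong_null_diff:
  fixes f g :: "'a \<Rightarrow> real"
  assumes "((\<lambda>x. f x - g x) has_sum 0) A"
  shows "(f summable_on A \<longleftrightarrow> g summable_on A) \<and> infsum f A = infsum g A"
proof -
  have "(f has_sum s) A \<longleftrightarrow> (g has_sum s) A" for s
    using has_sum_minus[OF _ assms, of f s] has_sum_add[OF _ assms, of g s] by auto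
  then show ?thesis
    by (simp add: infsum_def summable_on_def has_sum_def Topological_Spaces.Lim_def)
qed

text \<open>A discrete chain rule, with both sides zero on the diagonal; it supplies the assumption
  \<open>B\<close> of the local balance below.\<close>

lemma diff_quot_mult: "diff_quot W a b * (a - b) = W a - W b"
  by (simp add: diff_quot_def)

text \<open>Here \<open>u, w, z\<close> are the fields at times \<open>T + 1, T, T - 1\<close>, and \<open>p, m, q, r\<close> are the
  forward and backward neighbours of \<open>w\<close> and of \<open>z\<close>.\<close>

lemma local_energy_balance:
  fixes u w z :: "'a::real_inner" and p m q r :: "'j::finite \<Rightarrow> 'a"
  assumes eq: "a *\<^sub>R (u - 2 *\<^sub>R w + z) =
      (\<Sum>j\<in>UNIV. b *\<^sub>R (p j - 2 *\<^sub>R w + m j)) - B *\<^sub>R (u + z)"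
    and B: "B * ((norm u)\<^sup>2 - (norm z)\<^sup>2) = v' - v"
  shows "(a - real CARD('j) * b) * ((norm (u - w))\<^sup>2 - (norm (w - z))\<^sup>2) / 2
      + (\<Sum>j\<in>UNIV. b / 4 * ((norm (u - p j))\<^sup>2 + (norm (u - m j))\<^sup>2
           - (norm (w - q j))\<^sup>2 - (norm (w - r j))\<^sup>2))
      + (v' - v) / 2
    = (\<Sum>j\<in>UNIV. b / 4 *
        ((p j \<bullet> p j + m j \<bullet> m j - 2 * (w \<bullet> w)) - (q j \<bullet> q j + r j \<bullet> r j - 2 * (z \<bullet> z))
          + 2 * (w \<bullet> q j - z \<bullet> m j) + 2 * (w \<bullet> r j - z \<bullet> p j)))"
proof -
  \<comment> \<open>Since \<open>(u - z) \<bullet> (u + z)\<close> is the difference of the squared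
    norms, pairing the nonlinear term with \<open>u - z\<close> gives the potential
    increment.\<close>
  have "v' - v = (u - z) \<bullet> (B *\<^sub>R (u + z))"
    unfolding B[symmetric] power2_norm_eq_inner
    by (simp add: inner_simps inner_commute)
  also have "B *\<^sub>R (u + z) =
      (\<Sum>j\<in>UNIV. b *\<^sub>R (p j - 2 *\<^sub>R w + m j)) - a *\<^sub>R (u - 2 *\<^sub>R w + z)"
    using eq by simp
  also have "(u - z) \<bullet> \<dots> = (\<Sum>j\<in>UNIV. b * ((u - z) \<bullet> (p j - 2 *\<^sub>R w + m j)))
      - a * ((u - z) \<bullet> (u - 2 *\<^sub>R w + z))"
    by (simp add: inner_diff_right[of "u - z"] inner_sum_right del: inner_diff_left)
  finally have v: "(v' - v) / 2 = (\<Sum>j\<in>UNIV. b / 2 * ((u - z) \<bullet> (p j - 2 *\<^sub>R w + m j)))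
      - a / 2 * ((u - z) \<bullet> (u - 2 *\<^sub>R w + z))"
    by (simp add: sum_divide_distrib diff_divide_distrib)
  \<comment> \<open>The kinetic increment is the pairing of \<open>u - z\<close> with the second
    time difference, so the terms with factor \<open>a\<close> cancel.\<close>
  have d: "(norm (u - w))\<^sup>2 - (norm (w - z))\<^sup>2 = (u - z) \<bullet> (u - 2 *\<^sub>R w + z)"
    unfolding power2_norm_eq_inner by (simp add: inner_simps inner_commute)
  \<comment> \<open>The factor \<open>CARD('j)\<close> is spread over the directions, one
    \<open>b\<close> for each, so that only sums over \<open>j\<close> remain to be
    compared.\<close>
  have "(a - real CARD('j) * b) * ((norm (u - w))\<^sup>2 - (norm (w - z))\<^sup>2) / 2
      = a / 2 * ((u - z) \<bullet> (u - 2 *\<^sub>R w + z))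
        - (\<Sum>j\<in>(UNIV::'j set). b / 2 * ((u - z) \<bullet> (u - 2 *\<^sub>R w + z)))"
    unfolding d by (simp add: field_simps)
  then have "?thesis \<longleftrightarrow>
      (\<Sum>j\<in>UNIV. b / 4 * ((norm (u - p j))\<^sup>2 + (norm (u - m j))\<^sup>2
           - (norm (w - q j))\<^sup>2 - (norm (w - r j))\<^sup>2))
      + (\<Sum>j\<in>UNIV. b / 2 * ((u - z) \<bullet> (p j - 2 *\<^sub>R w + m j)))
      - (\<Sum>j\<in>(UNIV::'j set). b / 2 * ((u - z) \<bullet> (u - 2 *\<^sub>R w + z)))
    = (\<Sum>j\<in>UNIV. b / 4 *
        ((p j \<bullet> p j + m j \<bullet> m j - 2 * (w \<bullet> w)) - (q j \<bullet> q j + r j \<bullet> r j - 2 * (z \<bullet> z))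
          + 2 * (w \<bullet> q j - z \<bullet> m j) + 2 * (w \<bullet> r j - z \<bullet> p j)))"
    unfolding v by linarith
  \<comment> \<open>For each \<open>j\<close> all terms containing \<open>u\<close> cancel, thanks
    to the correction \<open>- CARD('j) * b\<close> in the kinetic coefficient; what is left
    involves only two time levels.\<close>
  also have "\<dots>"
    unfolding sum.distrib[symmetric] sum_subtractf[symmetric] power2_norm_eq_inner
    by (rule sum.cong) (simp_all add: inner_simps inner_commute algebra_simps)
  finally show ?thesis by simp
qed

text \<open>Every group is a difference of translates of a summable function. For the mixed terms,
  \<open>z X \<bullet> w (X - d)\<close> is the function \<open>w X \<bullet> z (X + d)\<close>
  taken at \<open>X - d\<close>.\<close>

lemma has_sum_neighbour_flux:
  fixes w z :: "'a::ab_group_add \<Rightarrow> 'b::real_inner"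
  assumes w: "(\<lambda>X. (norm (w X))\<^sup>2) summable_on UNIV"
    and z: "(\<lambda>X. (norm (z X))\<^sup>2) summable_on UNIV"
  shows "((\<lambda>X. (w (X + e) \<bullet> w (X + e) + w (X - e) \<bullet> w (X - e) - 2 * (w X \<bullet> w X))
      - (z (X + e) \<bullet> z (X + e) + z (X - e) \<bullet> z (X - e) - 2 * (z X \<bullet> z X))
      + 2 * (w X \<bullet> z (X + e) - z X \<bullet> w (X - e))
      + 2 * (w X \<bullet> z (X - e) - z X \<bullet> w (X + e))) has_sum 0) UNIV"
proof -
  have shift: "(\<lambda>X. (norm (z (X + d)))\<^sup>2) summable_on UNIV" for d
    using z has_sum_translate unfolding summable_on_def by blast
  have sq: "((\<lambda>X. f (X + d) \<bullet> f (X + d) - f X \<bullet> f X) has_sum 0) UNIV"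
    if "(\<lambda>X. (norm (f X))\<^sup>2) summable_on UNIV" for f :: "'a \<Rightarrow> 'b" and d
    using has_sum_translate_diff[OF summable_on_inner[OF that that], of d] .
  have cross: "((\<lambda>X. w X \<bullet> z (X + d) - z X \<bullet> w (X - d)) has_sum 0) UNIV" for d
    using has_sum_uminusI[OF
        has_sum_translate_diff[OF summable_on_inner[OF w shift[of d]], of "- d"]]
    by (simp add: inner_commute)
  \<comment> \<open>Second differences are split into shifts by \<open>e\<close> and by
    \<open>- e\<close>, and the zeros stay unevaluated, so that the summation rules match
    syntactically.\<close>
  have "((\<lambda>X. (w (X + e) \<bullet> w (X + e) - w X \<bullet> w X) + (w (X + - e) \<bullet> w (X + - e) - w X \<bullet> w X)
      - ((z (X + e) \<bullet> z (X + e) - z X \<bullet> z X) + (z (X + - e) \<bullet> z (X + - e) - z X \<bullet> z X))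
      + 2 * (w X \<bullet> z (X + e) - z X \<bullet> w (X - e))
      + 2 * (w X \<bullet> z (X + - e) - z X \<bullet> w (X - - e)))
     has_sum 0 + 0 - (0 + 0) + 2 * 0 + 2 * 0) UNIV"
    by (intro has_sum_add has_sum_minus has_sum_cmult_right sq w z cross)
  then show ?thesis
    by (simp add: algebra_simps)
qed

theorem theorem2p9:
  fixes \<tau> \<epsilon> :: real
    and V :: "int^'n \<Rightarrow> real \<Rightarrow> real"
    and \<psi> :: "int^'n \<Rightarrow> int \<Rightarrow> complex^'N"
  assumes "\<tau> > 0" and "\<epsilon> > 0"
    and "\<And>X. C2 (V X)"
    and "discrete_wave_eq \<tau> \<epsilon> V \<psi>"
    and "\<And>T. in_l2 (\<lambda>X. \<psi> X T)"
  shows "\<forall>T. (energy_density \<tau> \<epsilon> V \<psi> T summable_on UNIV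
                \<longleftrightarrow> energy_density \<tau> \<epsilon> V \<psi> (T - 1) summable_on UNIV)
            \<and> discrete_energy \<tau> \<epsilon> V \<psi> T = discrete_energy \<tau> \<epsilon> V \<psi> (T - 1)"
proof
  fix T
  define b where "b = 1 / \<epsilon>\<^sup>2"
  define F where "F j X =
     (\<psi> (X + axis j 1) T \<bullet> \<psi> (X + axis j 1) T + \<psi> (X - axis j 1) T \<bullet> \<psi> (X - axis j 1) T
        - 2 * (\<psi> X T \<bullet> \<psi> X T))
      - (\<psi> (X + axis j 1) (T - 1) \<bullet> \<psi> (X + axis j 1) (T - 1)
        + \<psi> (X - axis j 1) (T - 1) \<bullet> \<psi> (X - axis j 1) (T - 1)
        - 2 * (\<psi> X (T - 1) \<bullet> \<psi> X (T - 1)))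
      + 2 * (\<psi> X T \<bullet> \<psi> (X + axis j 1) (T - 1) - \<psi> X (T - 1) \<bullet> \<psi> (X - axis j 1) T)
      + 2 * (\<psi> X T \<bullet> \<psi> (X - axis j 1) (T - 1) - \<psi> X (T - 1) \<bullet> \<psi> (X + axis j 1) T)"
    for j X
  have "(F j has_sum 0) UNIV" for j
    unfolding F_def using assms(5) by (intro has_sum_neighbour_flux) (auto simp: in_l2_def)
  then have "((\<lambda>X. \<Sum>j\<in>UNIV. b / 4 * F j X) has_sum 0) UNIV"
    by (intro has_sum_zero_sum has_sum_cmult_right[where a = 0, simplified])
  from has_sum_cmult_left[OF this, of "\<epsilon> ^ CARD('n)"]
  have flux: "((\<lambda>X. (\<Sum>j\<in>UNIV. b / 4 * F j X) * \<epsilon> ^ CARD('n)) has_sum 0) UNIV"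
    by simp
  have "energy_density \<tau> \<epsilon> V \<psi> T X - energy_density \<tau> \<epsilon> V \<psi> (T - 1) X
      = (\<Sum>j\<in>UNIV. b / 4 * F j X) * \<epsilon> ^ CARD('n)" for X
  proof -
    have eq: "(1 / \<tau>\<^sup>2) *\<^sub>R (\<psi> X (T + 1) - 2 *\<^sub>R \<psi> X T + \<psi> X (T - 1)) =
        (\<Sum>j\<in>UNIV. b *\<^sub>R (\<psi> (X + axis j 1) T - 2 *\<^sub>R \<psi> X T + \<psi> (X - axis j 1) T))
        - diff_quot (V X) ((norm (\<psi> X (T + 1)))\<^sup>2) ((norm (\<psi> X (T - 1)))\<^sup>2)
            *\<^sub>R (\<psi> X (T + 1) + \<psi> X (T - 1))"
      using assms(4) by (simp add: discrete_wave_eq_def b_def inverse_eq_divide)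
    \<comment> \<open>The neighbours \<open>q\<close>, \<open>r\<close> at time \<open>T - 1\<close>
      do not occur in \<open>eq\<close>, hence the explicit instantiation.\<close>
    note bal = local_energy_balance[OF eq diff_quot_mult,
        where q = "\<lambda>j. \<psi> (X + axis j 1) (T - 1)" and r = "\<lambda>j. \<psi> (X - axis j 1) (T - 1)"]
    have gradient: "(\<Sum>j\<in>UNIV. (norm (\<psi> X (T + 1) - \<psi> (X + axis j 1) T))\<^sup>2 / (4 * \<epsilon>\<^sup>2)
            + (norm (\<psi> X (T + 1) - \<psi> (X - axis j 1) T))\<^sup>2 / (4 * \<epsilon>\<^sup>2))
        - (\<Sum>j\<in>UNIV. (norm (\<psi> X T - \<psi> (X + axis j 1) (T - 1)))\<^sup>2 / (4 * \<epsilon>\<^sup>2)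
            + (norm (\<psi> X T - \<psi> (X - axis j 1) (T - 1)))\<^sup>2 / (4 * \<epsilon>\<^sup>2))
      = (\<Sum>j\<in>UNIV. b / 4 * ((norm (\<psi> X (T + 1) - \<psi> (X + axis j 1) T))\<^sup>2
            + (norm (\<psi> X (T + 1) - \<psi> (X - axis j 1) T))\<^sup>2
            - (norm (\<psi> X T - \<psi> (X + axis j 1) (T - 1)))\<^sup>2
            - (norm (\<psi> X T - \<psi> (X - axis j 1) (T - 1)))\<^sup>2))"
      unfolding sum_subtractf[symmetric]
      by (rule sum.cong) (simp_all add: b_def add_divide_distrib diff_divide_distrib)
    \<comment> \<open>The density at \<open>T - 1\<close> mentions time \<open>T - 1 + 1\<close>,
      which \<open>diff_add_cancel\<close> turns into \<open>T\<close>.\<close>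
    show ?thesis
      unfolding F_def bal[symmetric] energy_density_def left_diff_distrib[symmetric]
        gradient[symmetric] diff_add_cancel
      by (simp add: b_def algebra_simps add_divide_distrib diff_divide_distrib)
  qed
  with flux have "((\<lambda>X. energy_density \<tau> \<epsilon> V \<psi> T X - energy_density \<tau> \<epsilon> V \<psi> (T - 1) X)
      has_sum 0) UNIV"
    by simp
  from summable_infsum_cong_null_diff[OF this]
  show "(energy_density \<tau> \<epsilon> V \<psi> T summable_on UNIV
           \<longleftrightarrow> energy_density \<tau> \<epsilon> V \<psi> (T - 1) summable_on UNIV)
        \<and> discrete_energy \<tau> \<epsilon> V \<psi> T = discrete_energy \<tau> \<epsilon> V \<psi> (T - 1)"
    by (simp add: discrete_energy_def)
qed

end
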